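(* Let $A\in\mathbb R^{m\times n}$, let $T\in\mathbb R^{n\times n}$ be nonsingular, and let $b\in\mathbb R^m$ be given. For $\sigma,\eta>0$ let $U$ be a random variable in $\mathbb R^n$ with density $$p(u|\eta)=\frac{|\det T|}{(2\pi\eta^2)^{n/2}}\exp\left(-\frac{\|Tu\|_2^2}{2\eta^2}\right),$$ and let $b$ have conditional density given $U=u$ $$p(b|u,\sigma)=(2\pi\sigma^2)^{-m/2}\exp\left(-\frac{\|Au-b\|_2^2}{2\sigma^2}\right).$$ Let $p(b)=p(b|\sigma,\eta)=\int_{\mathbb R^n}p(b|u,\sigma)\,p(u|\eta)\,du$. Then the values $\sigma,\eta$ which maximize $p(b)$ satisfy $$\sigma^2=\frac{\|Au_\lambda-b\|_2^2}{m-\mathrm{trace}(H^{-1}A^{\mathsf T}A)},\qquad \eta^2=\frac{\|Tu_\lambda\|_2^2}{n-\lambda\,\mathrm{trace}(H^{-1}T^{\mathsf T}T)},$$ where $\lambda=\sigma^2/\eta^2$, $H=A^{\mathsf T}A+\lambda T^{\mathsf T}T$ and $u_\lambda=H^{-1}A^{\mathsf T}b$.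
   Context: The vector $u_\lambda=H^{-1}A^{\mathsf T}b$ is the Tikhonov solution, i.e. the minimizer over $u\in\mathbb R^n$ of $\|Au-b\|_2^2+\lambda\|Tu\|_2^2$. The vector $b$ is held fixed; $\sigma$ and $\eta$ are the unknown parameters. Superscript $\mathsf T$ denotes matrix transpose.
   Formalization: The formula for η² is asserted only when A ≠ 0: for A = 0 the density p(b) does not depend on η, u_λ = 0 and n − λ trace(H⁻¹TᵀT) = 0, so the stated quotient is 0/0; the formula for σ² is asserted for every A. *)

theory Defs
  imports "HOL-Analysis.Analysis"
begin

definition prior_density :: "real^'n^'n \<Rightarrow> real \<Rightarrow> real^'n \<Rightarrow> real" where
  "prior_density T \<eta> u =
     \<bar>det T\<bar> / (2 * pi * \<eta>\<^sup>2) powr (real CARD('n) / 2) *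
     exp (- (norm (T *v u))\<^sup>2 / (2 * \<eta>\<^sup>2))"

definition likelihood :: "real^'n^'m \<Rightarrow> real \<Rightarrow> real^'n \<Rightarrow> real^'m \<Rightarrow> real" where
  "likelihood A \<sigma> u b =
     (2 * pi * \<sigma>\<^sup>2) powr (- (real CARD('m) / 2)) *
     exp (- (norm (A *v u - b))\<^sup>2 / (2 * \<sigma>\<^sup>2))"

definition evidence :: "real^'n^'m \<Rightarrow> real^'n^'n \<Rightarrow> real^'m \<Rightarrow> real \<Rightarrow> real \<Rightarrow> real" where
  "evidence A T b \<sigma> \<eta> = (\<integral>u. likelihood A \<sigma> u b * prior_density T \<eta> u \<partial>lborel)"

definition tikhonov_matrix :: "real^'n^'m \<Rightarrow> real^'n^'n \<Rightarrow> real \<Rightarrow> real^'n^'n" where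
  "tikhonov_matrix A T l = transpose A ** A + l *\<^sub>R (transpose T ** T)"

definition tikhonov_solution :: "real^'n^'m \<Rightarrow> real^'n^'n \<Rightarrow> real^'m \<Rightarrow> real \<Rightarrow> real^'n" where
  "tikhonov_solution A T b l = matrix_inv (tikhonov_matrix A T l) *v (transpose A *v b)"

text \<open>
  If \<open>A = 0\<close>, then \<open>evidence A T b \<sigma> \<eta>\<close> does not depend on \<open>\<eta>\<close> and the quotient characterising
  \<open>\<eta>\<^sup>2\<close> at a maximizer is the undefined expression \<open>0 / 0\<close>.  Since HOL sets \<open>0 / 0 = 0\<close>, a
  statement about that quotient must be restricted to \<open>A \<noteq> 0\<close>, where the denominator is positive.
  The denominator of the quotient for \<open>\<sigma>\<^sup>2\<close> is always positive.
\<close>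

end

theory Submission imports Defs "HOL-Probability.Distributions" begin

text \<open>
  Both formulas equate two expressions for a posterior mean.

  The evidence is a constant times \<open>\<sigma>\<^sup>-\<^sup>m \<eta>\<^sup>-\<^sup>n\<close> times the integral over \<open>u\<close> of
  \<open>exp (- norm (A u - b)\<^sup>2 / (2 \<sigma>\<^sup>2) - norm (T u)\<^sup>2 / (2 \<eta>\<^sup>2))\<close>.  Stationarity in \<open>\<sigma>\<close> alone and in \<open>\<eta>\<close>
  alone says that, under the posterior distribution of \<open>u\<close>, the mean of \<open>norm (A u - b)\<^sup>2\<close> is \<open>m \<sigma>\<^sup>2\<close>
  and the mean of \<open>norm (T u)\<^sup>2\<close> is \<open>n \<eta>\<^sup>2\<close> (\<open>evidence_maximizer_stationarity\<close>).  On the other hand the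
  posterior is Gaussian with mean the Tikhonov solution \<open>u\<^sub>\<lambda>\<close> and covariance \<open>\<sigma>\<^sup>2\<close> times the inverse
  of \<open>H\<close> (\<open>posterior_kernel_complete_square\<close>, \<open>integral_second_moment\<close>).  So the same means are
  \<open>norm (A u\<^sub>\<lambda> - b)\<^sup>2\<close> plus \<open>\<sigma>\<^sup>2\<close> times the trace of \<open>H\<^sup>-\<^sup>1 A\<^sup>T A\<close>, and \<open>norm (T u\<^sub>\<lambda>)\<^sup>2\<close> plus
  \<open>\<sigma>\<^sup>2 = \<lambda> \<eta>\<^sup>2\<close> times the trace of \<open>H\<^sup>-\<^sup>1 T\<^sup>T T\<close> (\<open>posterior_expected_residual\<close>).  Solving for \<open>\<sigma>\<^sup>2\<close> and
  \<open>\<eta>\<^sup>2\<close> requires nonzero denominators.  The first one is positive because every leverage is less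
  than 1 (\<open>trace_influence_less\<close>).  The second one equals the trace of \<open>H\<^sup>-\<^sup>1 A\<^sup>T A\<close>, which is positive
  for \<open>A \<noteq> 0\<close> (\<open>trace_tikhonov_split\<close>, \<open>trace_influence_pos\<close>).

  Neither the Gaussian normalization constant, with the determinant of \<open>H\<close>, nor differentiation
  under the integral sign enters.  The derivatives are replaced by the tangent bound
  \<open>1 + x \<le> exp x\<close>: it gives an explicit lower bound for an integral that is maximal (when a scale
  varies) or constant (when the integrand is translated), with equality at the base point, and the
  derivative of the explicit bound must then vanish there (\<open>scale_stationarity\<close>,
  \<open>integral_directional_derivative_eq_0\<close>).  Translations alone yield all the second moments.
\<close>


section \<open>Integrability against a Gaussian\<close>

text \<open>
  The square of the norm splits over an orthonormal basis, so the integral is a product of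
  one-dimensional Gaussian integrals.
\<close>

lemma integrable_exp_neg_norm_square:
  assumes "0 < c"
  shows "integrable lborel (\<lambda>x::'a::euclidean_space. exp (- c * (norm x)\<^sup>2))"
proof -
  have one_dim: "(\<integral>\<^sup>+x. ennreal (exp (- c * x\<^sup>2)) \<partial>lborel) < \<infinity>"
  proof -
    define s where "s = sqrt (1 / (2 * c))"
    have s: "2 * s\<^sup>2 = 1 / c" "s \<noteq> 0" using assms by (auto simp: s_def field_simps)
    have "integrable lborel (\<lambda>x. sqrt (2 * pi * s\<^sup>2) * normal_density 0 s x)"
      using s by (intro integrable_mult_right integrable_normal_density) (use assms in \<open>simp add: s_def\<close>)
    also have "(\<lambda>x. sqrt (2 * pi * s\<^sup>2) * normal_density 0 s x) = (\<lambda>x. exp (- c * x\<^sup>2))"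
      using s assms by (auto simp: normal_density_def fun_eq_iff)
    finally show ?thesis by (simp add: integrable_iff_bounded)
  qed
  have "(\<integral>\<^sup>+x. ennreal (exp (- c * (norm (x::'a))\<^sup>2)) \<partial>lborel)
      = (\<integral>\<^sup>+x. (\<Prod>b\<in>Basis. ennreal (exp (- c * ((x::'a) \<bullet> b)\<^sup>2))) \<partial>lborel)"
  proof (rule nn_integral_cong)
    fix x :: 'a
    have "(norm x)\<^sup>2 = (\<Sum>b\<in>Basis. (x \<bullet> b)\<^sup>2)"
      unfolding power2_norm_eq_inner by (subst euclidean_inner) (simp add: power2_eq_square)
    then have "exp (- c * (norm x)\<^sup>2) = (\<Prod>b\<in>Basis. exp (- c * (x \<bullet> b)\<^sup>2))"
      by (simp add: exp_sum[symmetric] sum_distrib_left sum_negf)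
    then show "ennreal (exp (- c * (norm x)\<^sup>2)) = (\<Prod>b\<in>Basis. ennreal (exp (- c * (x \<bullet> b)\<^sup>2)))"
      by (simp add: prod_ennreal)
  qed
  also have "\<dots> = (\<Prod>b\<in>(Basis :: 'a set). (\<integral>\<^sup>+x. ennreal (exp (- c * x\<^sup>2)) \<partial>lborel))"
    by (rule nn_integral_lborel_prod) auto
  also have "\<dots> < \<infinity>"
    using one_dim by (simp add: power_less_top_ennreal)
  finally show ?thesis by (simp add: integrable_iff_bounded)
qed

text \<open>
  The moments below are polynomial weights times a Gaussian.  Measurable functions of at most
  exponential growth contain them and are closed under sums and products with no bookkeeping of
  degrees: constants add or multiply, rates add or take a maximum.
\<close>

definition exp_growth :: "('a::euclidean_space \<Rightarrow> real) \<Rightarrow> bool" where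
  "exp_growth g \<longleftrightarrow> g \<in> borel_measurable borel \<and> (\<exists>K a. 0 \<le> K \<and> (\<forall>x. \<bar>g x\<bar> \<le> K * exp (a * norm x)))"

lemma exp_growthE:
  assumes "exp_growth g"
  obtains K a where "0 \<le> K" "\<And>x. \<bar>g x\<bar> \<le> K * exp (a * norm x)"
  using assms unfolding exp_growth_def by metis

lemma exp_growth_const: "exp_growth (\<lambda>_. k)"
  unfolding exp_growth_def by (intro conjI exI[of _ "\<bar>k\<bar>"] exI[of _ 0]) auto

lemma exp_growth_linear:
  fixes f :: "'a::euclidean_space \<Rightarrow> real"
  assumes "linear f"
  shows "exp_growth f"
proof -
  obtain B where B: "B > 0" "\<And>x. \<bar>f x\<bar> \<le> B * norm x"
    using linear_bounded_pos[OF assms] by auto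
  have "\<bar>f x\<bar> \<le> B * exp (1 * norm x)" for x
  proof -
    have "norm x \<le> exp (1 * norm x)" unfolding mult_1 by (rule order_trans[OF _ exp_ge_add_one_self]) simp
    with B show ?thesis by (meson less_imp_le mult_left_mono order_trans)
  qed
  moreover have "f \<in> borel_measurable borel"
    by (intro borel_measurable_continuous_onI linear_continuous_on) (use assms linear_conv_bounded_linear in blast)
  ultimately show ?thesis unfolding exp_growth_def using B(1) by (intro conjI exI[of _ B] exI[of _ 1]) auto
qed

lemma exp_growth_mult:
  assumes f: "exp_growth f" and g: "exp_growth g"
  shows "exp_growth (\<lambda>x. f x * g x)"
proof -
  obtain K a where K: "0 \<le> K" "\<And>x. \<bar>f x\<bar> \<le> K * exp (a * norm x)" using f exp_growthE by metis
  obtain L b where L: "0 \<le> L" "\<And>x. \<bar>g x\<bar> \<le> L * exp (b * norm x)" using g exp_growthE by metis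
  have "\<bar>f x * g x\<bar> \<le> (K * L) * exp ((a + b) * norm x)" for x
    using mult_mono[OF K(2) L(2), of x x] K L by (simp add: abs_mult exp_add algebra_simps)
  moreover have "(\<lambda>x. f x * g x) \<in> borel_measurable borel"
    using f g by (auto simp: exp_growth_def)
  ultimately show ?thesis unfolding exp_growth_def using K(1) L(1) by (metis mult_nonneg_nonneg)
qed

lemma exp_growth_add:
  assumes f: "exp_growth f" and g: "exp_growth g"
  shows "exp_growth (\<lambda>x. f x + g x)"
proof -
  obtain K a where K: "0 \<le> K" "\<And>x. \<bar>f x\<bar> \<le> K * exp (a * norm x)" using f exp_growthE by metis
  obtain L b where L: "0 \<le> L" "\<And>x. \<bar>g x\<bar> \<le> L * exp (b * norm x)" using g exp_growthE by metis
  have "\<bar>f x + g x\<bar> \<le> (K + L) * exp (max a b * norm x)" for x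
  proof -
    have "K * exp (a * norm x) \<le> K * exp (max a b * norm x)" "L * exp (b * norm x) \<le> L * exp (max a b * norm x)"
      using K(1) L(1) by (auto intro!: mult_left_mono mult_right_mono)
    with K(2)[of x] L(2)[of x] show ?thesis by (simp add: algebra_simps)
  qed
  moreover have "(\<lambda>x. f x + g x) \<in> borel_measurable borel"
    using f g by (auto simp: exp_growth_def)
  ultimately show ?thesis unfolding exp_growth_def using K(1) L(1) by (metis add_nonneg_nonneg)
qed

lemma exp_growth_abs: "exp_growth g \<Longrightarrow> exp_growth (\<lambda>x. \<bar>g x\<bar>)"
  unfolding exp_growth_def by auto

lemma exp_growth_diff:
  assumes "exp_growth f" "exp_growth g"
  shows "exp_growth (\<lambda>x. f x - g x)"
  using exp_growth_add[OF assms(1) exp_growth_mult[OF exp_growth_const[of "-1"] assms(2)]] by simp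

lemma exp_growth_power2: "exp_growth g \<Longrightarrow> exp_growth (\<lambda>x. (g x)\<^sup>2)"
  by (simp add: power2_eq_square exp_growth_mult)

text \<open>
  Half of the quadratic decay absorbs the exponential growth: by completing the square,
  \<open>a r - c r\<^sup>2 \<le> a\<^sup>2 / (2 c) - (c / 2) r\<^sup>2\<close>.
\<close>

lemma integrable_exp_growth_gaussian:
  fixes g q :: "'a::euclidean_space \<Rightarrow> real"
  assumes g: "exp_growth g" and c: "0 < c"
    and q: "q \<in> borel_measurable borel" "\<And>x. c * (norm x)\<^sup>2 \<le> q x"
  shows "integrable lborel (\<lambda>x. g x * exp (- q x))"
proof -
  obtain K a where K: "0 \<le> K" "\<And>x. \<bar>g x\<bar> \<le> K * exp (a * norm x)" using g exp_growthE by metis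
  have "integrable lborel (\<lambda>x::'a. (K * exp (a\<^sup>2 / (2 * c))) * exp (- (c / 2) * (norm x)\<^sup>2))"
    using c by (intro integrable_mult_right integrable_exp_neg_norm_square) auto
  then show ?thesis
  proof (rule Bochner_Integration.integrable_bound)
    show "(\<lambda>x. g x * exp (- q x)) \<in> borel_measurable lborel"
      using g q by (auto simp: exp_growth_def)
    show "AE x in lborel. norm (g x * exp (- q x))
            \<le> norm ((K * exp (a\<^sup>2 / (2 * c))) * exp (- (c / 2) * (norm x)\<^sup>2))"
    proof (rule AE_I2)
      fix x :: 'a
      have "0 \<le> (c * norm x - a)\<^sup>2 / (2 * c)" using c by simp
      also have "\<dots> = a\<^sup>2 / (2 * c) - a * norm x + (c / 2) * (norm x)\<^sup>2"
        using c by (simp add: power2_eq_square field_simps)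
      finally have "a * norm x + - q x \<le> a\<^sup>2 / (2 * c) + - (c / 2) * (norm x)\<^sup>2"
        using q(2)[of x] by simp
      then have "exp (a * norm x) * exp (- q x) \<le> exp (a\<^sup>2 / (2 * c)) * exp (- (c / 2) * (norm x)\<^sup>2)"
        unfolding exp_add[symmetric] by simp
      then have "K * (exp (a * norm x) * exp (- q x))
          \<le> K * (exp (a\<^sup>2 / (2 * c)) * exp (- (c / 2) * (norm x)\<^sup>2))"
        using K(1) by (rule mult_left_mono)
      moreover have "\<bar>g x\<bar> * exp (- q x) \<le> K * exp (a * norm x) * exp (- q x)"
        by (intro mult_right_mono K) auto
      ultimately show "norm (g x * exp (- q x)) \<le> norm ((K * exp (a\<^sup>2 / (2 * c))) * exp (- (c / 2) * (norm x)\<^sup>2))"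
        unfolding real_norm_def abs_mult abs_exp_cancel abs_of_nonneg[OF K(1)] mult.assoc by linarith
    qed
  qed
qed

section \<open>Stationarity without differentiating under the integral\<close>

lemma integral_lborel_translate:
  fixes f :: "'a::euclidean_space \<Rightarrow> real"
  assumes "f \<in> borel_measurable borel"
  shows "(\<integral>x. f (c + x) \<partial>lborel) = (\<integral>x. f x \<partial>lborel)"
proof -
  have "(\<integral>x. f x \<partial>lborel) = (\<integral>x. f x \<partial>distr lborel borel ((+) c))"
    by (simp add: lborel_distr_plus)
  also have "\<dots> = (\<integral>x. f (c + x) \<partial>lborel)"
    using assms by (intro integral_distr) auto
  finally show ?thesis ..
qed

lemma integrable_lborel_translate:
  fixes f :: "'a::euclidean_space \<Rightarrow> real"
  assumes "integrable lborel f"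
  shows "integrable lborel (\<lambda>x. f (c + x))"
proof -
  have "integrable (distr lborel borel ((+) c)) f"
    using assms by (simp add: lborel_distr_plus)
  then show ?thesis by (rule integrable_distr[rotated]) auto
qed

lemma linear_le_quadratic_imp_zero:
  fixes D :: real
  assumes "\<And>e. \<bar>e\<bar> \<le> 1 \<Longrightarrow> e * D \<le> e\<^sup>2 * R"
  shows "D = 0"
proof (rule ccontr)
  assume D: "D \<noteq> 0"
  define e where "e = D / (\<bar>D\<bar> + \<bar>R\<bar>)"
  have pos: "0 < \<bar>D\<bar> + \<bar>R\<bar>" using D by linarith
  have "e * D \<le> e\<^sup>2 * R" by (rule assms) (use pos in \<open>simp add: e_def\<close>)
  then have "D\<^sup>2 * (\<bar>D\<bar> + \<bar>R\<bar>) \<le> D\<^sup>2 * R"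
    using pos by (simp add: e_def power_divide divide_simps power2_eq_square mult_ac split: if_splits)
  then have "\<bar>D\<bar> + \<bar>R\<bar> \<le> R" using D by simp
  then show False using D by simp
qed

text \<open>
  Integration by parts.  Here \<open>d\<close> plays the derivative of \<open>f\<close> in direction \<open>h\<close>.  A one-sided
  second-order bound suffices: the integral of \<open>f\<close> does not change under translation, so the
  integral of the lower bound, a function of \<open>e\<close>, touches a constant from below at \<open>e = 0\<close>.
\<close>

lemma integral_directional_derivative_eq_0:
  fixes f d r :: "'a::euclidean_space \<Rightarrow> real"
  assumes f: "integrable lborel f" and d: "integrable lborel d" and r: "integrable lborel r"
    and below: "\<And>e x. \<bar>e\<bar> \<le> 1 \<Longrightarrow> f x + e * d x - e\<^sup>2 * r x \<le> f (e *\<^sub>R h + x)"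
  shows "(\<integral>x. d x \<partial>lborel) = 0"
proof (rule linear_le_quadratic_imp_zero)
  fix e :: real assume e: "\<bar>e\<bar> \<le> 1"
  have "(\<integral>x. f x \<partial>lborel) + e * (\<integral>x. d x \<partial>lborel) - e\<^sup>2 * (\<integral>x. r x \<partial>lborel)
      = (\<integral>x. f x + e * d x - e\<^sup>2 * r x \<partial>lborel)"
    using f d r by simp
  also have "\<dots> \<le> (\<integral>x. f (e *\<^sub>R h + x) \<partial>lborel)"
    using f d r e by (intro integral_mono integrable_lborel_translate below) auto
  also have "\<dots> = (\<integral>x. f x \<partial>lborel)"
    using f by (intro integral_lborel_translate) auto
  finally show "e * (\<integral>x. d x \<partial>lborel) \<le> e\<^sup>2 * (\<integral>x. r x \<partial>lborel)" by simp
qed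

text \<open>
  The first-order condition for the scale \<open>v\<close> in a Gaussian-type factor
  \<open>v powr (- k) * exp (- R / (2 v))\<close>: at a maximizing \<open>v\<close>, the mean of \<open>R\<close> under the normalized
  weight is \<open>2 k v\<close>.  Put \<open>v' = v / a\<close>.  By \<open>1 + x \<le> exp x\<close> the integral is bounded below by an
  affine function of \<open>a\<close>, with equality at \<open>a = 1\<close>.  So the product of \<open>a powr k\<close> and this affine
  function is also maximal at \<open>a = 1\<close>, and its derivative there is explicit.
\<close>

lemma scale_stationarity:
  fixes R w :: "'a \<Rightarrow> real"
  assumes int: "\<And>v'. 0 < v' \<Longrightarrow> integrable M (\<lambda>u. exp (- R u / (2 * v')) * w u)"
    and R: "R \<in> borel_measurable M" "\<And>u. 0 \<le> R u" and w: "\<And>u. 0 \<le> w u" and v: "0 < v"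
    and opt: "\<And>v'. 0 < v' \<Longrightarrow> v' powr (- k) * (\<integral>u. exp (- R u / (2 * v')) * w u \<partial>M)
                   \<le> v powr (- k) * (\<integral>u. exp (- R u / (2 * v)) * w u \<partial>M)"
  shows "(\<integral>u. R u * (exp (- R u / (2 * v)) * w u) \<partial>M)
       = 2 * k * v * (\<integral>u. exp (- R u / (2 * v)) * w u \<partial>M)"
proof -
  define E where "E = (\<lambda>u. exp (- R u / (2 * v)) * w u)"
  define Z where "Z = (\<integral>u. E u \<partial>M)"
  define S where "S = (\<integral>u. R u * E u \<partial>M)"
  have E: "integrable M E" unfolding E_def using int v by simp
  have RE: "integrable M (\<lambda>u. R u * E u)"
  proof (rule Bochner_Integration.integrable_bound)
    \<comment> \<open>Half of the exponent, that is scale \<open>2 * v\<close>, pays for the factor \<open>R\<close>, because \<open>y * exp (- y) \<le> 1\<close>.\<close>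
    show "integrable M (\<lambda>u. 4 * v * (exp (- R u / (2 * (2 * v))) * w u))"
      using v by (intro integrable_mult_right int) auto
    show "(\<lambda>u. R u * E u) \<in> borel_measurable M" using R E by auto
    show "AE u in M. norm (R u * E u) \<le> norm (4 * v * (exp (- R u / (2 * (2 * v))) * w u))"
    proof (rule AE_I2)
      fix u
      define y where "y = R u / (4 * v)"
      have y: "R u = 4 * v * y" "0 \<le> y" using v R(2)[of u] by (auto simp: y_def)
      have "y \<le> exp y" by (rule order_trans[OF _ exp_ge_add_one_self]) simp
      then have "y * exp (- y) \<le> 1" by (simp add: exp_minus divide_simps)
      then have "y * exp (- y) * (4 * v * exp (- y) * w u) \<le> 1 * (4 * v * exp (- y) * w u)"
        using v w by (intro mult_right_mono) auto
      moreover have "exp (- R u / (2 * v)) = exp (- y) * exp (- y)"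
        unfolding exp_add[symmetric] using v by (simp add: y)
      moreover have "exp (- R u / (2 * (2 * v))) = exp (- y)" using v by (simp add: y)
      ultimately show "norm (R u * E u) \<le> norm (4 * v * (exp (- R u / (2 * (2 * v))) * w u))"
        using v w[of u] R(2)[of u] by (simp add: E_def abs_mult y mult_ac)
    qed
  qed
  define \<phi> where "\<phi> = (\<lambda>a. a powr k * (Z - (a - 1) * S / (2 * v)))"
  have le: "\<phi> a \<le> \<phi> 1" if a: "0 < a" for a
  proof -
    have "Z - (a - 1) * S / (2 * v) = (\<integral>u. E u - (a - 1) / (2 * v) * (R u * E u) \<partial>M)"
      using E RE by (simp add: Z_def S_def)
    also have "\<dots> \<le> (\<integral>u. exp (- R u / (2 * (v / a))) * w u \<partial>M)"
    proof (rule integral_mono)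
      show "integrable M (\<lambda>u. E u - (a - 1) / (2 * v) * (R u * E u))" using E RE by auto
      show "integrable M (\<lambda>u. exp (- R u / (2 * (v / a))) * w u)" using int[of "v / a"] a v by simp
      fix u
      have "1 + (- (a - 1) * R u / (2 * v)) \<le> exp (- (a - 1) * R u / (2 * v))"
        by (rule exp_ge_add_one_self)
      then have "(1 + (- (a - 1) * R u / (2 * v))) * E u \<le> exp (- (a - 1) * R u / (2 * v)) * E u"
        using w by (intro mult_right_mono) (auto simp: E_def)
      moreover have "exp (- (a - 1) * R u / (2 * v)) * exp (- R u / (2 * v)) = exp (- R u / (2 * (v / a)))"
        unfolding exp_add[symmetric] using v a by (simp add: field_simps)
      ultimately show "E u - (a - 1) / (2 * v) * (R u * E u) \<le> exp (- R u / (2 * (v / a))) * w u"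
        by (simp add: E_def algebra_simps add_divide_distrib diff_divide_distrib)
    qed
    finally have "v powr (- k) * \<phi> a \<le> (v powr (- k) * a powr k) * (\<integral>u. exp (- R u / (2 * (v / a))) * w u \<partial>M)"
      by (simp add: \<phi>_def mult_left_mono mult.assoc)
    also have "v powr (- k) * a powr k = (v / a) powr (- k)"
      using v a by (simp add: powr_divide powr_minus field_simps)
    also have "(v / a) powr (- k) * (\<integral>u. exp (- R u / (2 * (v / a))) * w u \<partial>M) \<le> v powr (- k) * Z"
      unfolding Z_def E_def using v a by (intro opt) auto
    finally have "v powr (- k) * \<phi> a \<le> v powr (- k) * \<phi> 1" by (simp add: \<phi>_def)
    moreover have "0 < v powr (- k)" using v by (metis powr_gt_zero less_irrefl)
    ultimately show ?thesis by (simp only: mult_le_cancel_left_pos)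
  qed
  have "DERIV \<phi> 1 :> k * Z - S / (2 * v)"
    unfolding \<phi>_def using v by (auto intro!: derivative_eq_intros)
  then have "k * Z - S / (2 * v) = 0"
    by (rule DERIV_local_max[where d = 1]) (auto intro!: le)
  then have "S = 2 * k * v * Z" using v by (simp add: field_simps)
  then show ?thesis by (simp add: S_def Z_def E_def)
qed

section \<open>Moments of a Gaussian with a given precision operator\<close>

text \<open>
  The unnormalized centred Gaussian with precision operator \<open>H / s\<close>, hence with covariance
  \<open>s\<close> times the inverse of \<open>H\<close>.  No inverse is mentioned: the moment formulas below are stated for functionals of the
  form \<open>h \<bullet> H x\<close>, whose representing vector \<open>H h\<close> ranges over the whole space.
\<close>

locale gaussian_weight =
  fixes H :: "'a::euclidean_space \<Rightarrow> 'a" and s c :: real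
  assumes lin: "linear H" and sym: "\<And>x y. x \<bullet> H y = H x \<bullet> y"
    and s: "0 < s" and c: "0 < c" and coercive: "\<And>x. c * (norm x)\<^sup>2 \<le> x \<bullet> H x"
begin

definition G :: "'a \<Rightarrow> real" where "G x = exp (- ((x \<bullet> H x) / (2 * s)))"

lemma G_pos: "0 < G x"
  by (simp add: G_def)

lemma exp_growth_inner_H: "exp_growth (\<lambda>x. h \<bullet> H x)"
  by (intro exp_growth_linear linearI) (simp_all add: lin linear_add linear_scale inner_add_right)

lemma exp_growth_inner: "exp_growth (\<lambda>x::'a. k \<bullet> x)"
  by (intro exp_growth_linear linearI) (simp_all add: inner_add_right)

lemmas growth_intros = exp_growth_const exp_growth_inner exp_growth_inner_H exp_growth_add exp_growth_diff
  exp_growth_mult exp_growth_power2 exp_growth_abs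

lemma integrable_G: "exp_growth g \<Longrightarrow> integrable lborel (\<lambda>x. g x * G x)"
  unfolding G_def
proof (rule integrable_exp_growth_gaussian)
  show "0 < c / (2 * s)" using c s by simp
  have "H \<in> borel_measurable borel"
    using lin by (intro borel_measurable_continuous_onI linear_continuous_on) (simp add: linear_conv_bounded_linear)
  then show "(\<lambda>x. x \<bullet> H x / (2 * s)) \<in> borel_measurable borel" by measurable
  show "c / (2 * s) * (norm x)\<^sup>2 \<le> x \<bullet> H x / (2 * s)" for x
    using coercive[of x] s by (simp add: divide_right_mono)
qed

text \<open>
  The exponent of the translate is an exact quadratic in \<open>e\<close>, and \<open>1 + x \<le> exp x\<close> turns it into the
  polynomial lower bound that integration by parts needs.
\<close>

lemma G_translate_ge:
  "G x * (1 - e * (h \<bullet> H x / s) - e\<^sup>2 * (h \<bullet> H h / (2 * s))) \<le> G (e *\<^sub>R h + x)"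
proof -
  have "(e *\<^sub>R h + x) \<bullet> H (e *\<^sub>R h + x) = x \<bullet> H x + 2 * e * (h \<bullet> H x) + e\<^sup>2 * (h \<bullet> H h)"
    using sym[of x h]
    by (simp add: lin linear_add linear_scale inner_add_left inner_add_right power2_eq_square
        inner_commute algebra_simps)
  then have "G (e *\<^sub>R h + x) = G x * exp (- e * (h \<bullet> H x / s) - e\<^sup>2 * (h \<bullet> H h / (2 * s)))"
    unfolding G_def exp_add[symmetric] using s by (simp add: field_simps)
  moreover have "1 - e * (h \<bullet> H x / s) - e\<^sup>2 * (h \<bullet> H h / (2 * s))
      \<le> exp (- e * (h \<bullet> H x / s) - e\<^sup>2 * (h \<bullet> H h / (2 * s)))"
    using exp_ge_add_one_self[of "- e * (h \<bullet> H x / s) - e\<^sup>2 * (h \<bullet> H h / (2 * s))"] by linarith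
  ultimately show ?thesis using G_pos[of x] by simp
qed

lemma integral_first_moment: "(\<integral>x. (h \<bullet> H x) * G x \<partial>lborel) = 0"
proof -
  have "(\<integral>x. (- 1 / s * (h \<bullet> H x)) * G x \<partial>lborel) = 0"
  proof (rule integral_directional_derivative_eq_0)
    show "integrable lborel G" using integrable_G[OF exp_growth_const[of 1]] by simp
    show "integrable lborel (\<lambda>x. (- 1 / s * (h \<bullet> H x)) * G x)" by (intro integrable_G growth_intros)
    show "integrable lborel (\<lambda>x. (h \<bullet> H h / (2 * s)) * G x)" by (intro integrable_G growth_intros)
    show "G x + e * ((- 1 / s * (h \<bullet> H x)) * G x) - e\<^sup>2 * ((h \<bullet> H h / (2 * s)) * G x) \<le> G (e *\<^sub>R h + x)"
      for e x using G_translate_ge[of x e h] by (simp add: algebra_simps)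
  qed
  then show ?thesis using s by (simp add: mult.assoc)
qed

text \<open>
  Integration by parts for \<open>(m + k \<bullet> x)\<^sup>2 * G x\<close>.  The natural choice \<open>(k \<bullet> x) * G x\<close> changes sign, so
  the lower bound on \<open>G\<close> could not be multiplied by its first factor; a square is
  nonnegative.  The extra terms that it brings are even in \<open>m\<close>, so that subtracting the instances
  \<open>m = 1\<close> and \<open>m = -1\<close> removes them.
\<close>

lemma integral_square_shift:
  "(\<integral>x. (2 * (k \<bullet> h) * (m + k \<bullet> x) - (m + k \<bullet> x)\<^sup>2 * (1 / s * (h \<bullet> H x))) * G x \<partial>lborel) = 0"
proof (rule integral_directional_derivative_eq_0)
  define a where "a = k \<bullet> h"
  define t where "t = h \<bullet> H h / (2 * s)"
  define g where "g x = m + k \<bullet> x" for x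
  define y where "y x = 1 / s * (h \<bullet> H x)" for x
  \<comment> \<open>The coefficients of \<open>e\<^sup>2\<close>, \<open>e ^ 3\<close> and \<open>e ^ 4\<close> in \<open>(g x + e * a)\<^sup>2 * (1 - e * y x - e\<^sup>2 * t)\<close>, in absolute value.\<close>
  define r where "r x = \<bar>a\<^sup>2 - 2 * a * g x * y x - t * (g x)\<^sup>2\<bar> + \<bar>a\<^sup>2 * y x + 2 * a * t * g x\<bar> + \<bar>a\<^sup>2 * t\<bar>" for x
  have g: "exp_growth g" and y: "exp_growth y" unfolding g_def y_def by (intro growth_intros)+
  show "integrable lborel (\<lambda>x. (g x)\<^sup>2 * G x)" by (intro integrable_G exp_growth_power2 g)
  show "integrable lborel (\<lambda>x. (2 * (k \<bullet> h) * (m + k \<bullet> x) - (m + k \<bullet> x)\<^sup>2 * (1 / s * (h \<bullet> H x))) * G x)"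
    by (intro integrable_G growth_intros)
  show "integrable lborel (\<lambda>x. r x * G x)"
    unfolding r_def using g y
    by (intro integrable_G exp_growth_add exp_growth_abs exp_growth_diff exp_growth_mult
        exp_growth_power2 exp_growth_const)
  fix e :: real and x assume e: "\<bar>e\<bar> \<le> 1"
  have shift: "g (e *\<^sub>R h + x) = g x + e * a"
    by (simp add: g_def a_def inner_add_right)
  have rem: "- (e\<^sup>2 * r x) \<le> e\<^sup>2 * (a\<^sup>2 - 2 * a * g x * y x - t * (g x)\<^sup>2)
        - e ^ 3 * (a\<^sup>2 * y x + 2 * a * t * g x) - e ^ 4 * (a\<^sup>2 * t)"
  proof -
    have scale: "e\<^sup>2 * b * z \<le> e\<^sup>2 * \<bar>z\<bar>" if "\<bar>b\<bar> \<le> 1" for b z :: real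
    proof -
      have "b * z \<le> \<bar>b\<bar> * \<bar>z\<bar>" by (metis abs_ge_self abs_mult)
      also have "\<dots> \<le> \<bar>z\<bar>" using that by (simp add: mult_left_le_one_le)
      finally show ?thesis by (simp add: mult.assoc mult_left_mono)
    qed
    have "\<bar>e\<^sup>2\<bar> \<le> 1" using e by (simp add: abs_square_le_1)
    then have "e\<^sup>2 * e\<^sup>2 * (a\<^sup>2 * t) \<le> e\<^sup>2 * \<bar>a\<^sup>2 * t\<bar>" by (rule scale)
    moreover have "e\<^sup>2 * e * (a\<^sup>2 * y x + 2 * a * t * g x) \<le> e\<^sup>2 * \<bar>a\<^sup>2 * y x + 2 * a * t * g x\<bar>"
      using e by (rule scale)
    moreover have "e\<^sup>2 * (- 1) * (a\<^sup>2 - 2 * a * g x * y x - t * (g x)\<^sup>2) \<le> e\<^sup>2 * \<bar>a\<^sup>2 - 2 * a * g x * y x - t * (g x)\<^sup>2\<bar>"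
      by (rule scale) simp
    ultimately show ?thesis
      by (simp add: r_def power2_eq_square power3_eq_cube power4_eq_xxxx distrib_left mult_ac)
  qed
  have "(g x)\<^sup>2 + e * (2 * a * g x - (g x)\<^sup>2 * y x) - e\<^sup>2 * r x
      \<le> (g x + e * a)\<^sup>2 * (1 - e * y x - e\<^sup>2 * t)"
  proof -
    have "(g x + e * a)\<^sup>2 * (1 - e * y x - e\<^sup>2 * t) = (g x)\<^sup>2 + e * (2 * a * g x - (g x)\<^sup>2 * y x)
       + (e\<^sup>2 * (a\<^sup>2 - 2 * a * g x * y x - t * (g x)\<^sup>2)
          - e ^ 3 * (a\<^sup>2 * y x + 2 * a * t * g x) - e ^ 4 * (a\<^sup>2 * t))"
      by algebra
    with rem show ?thesis by linarith
  qed
  then have "((g x)\<^sup>2 + e * (2 * a * g x - (g x)\<^sup>2 * y x) - e\<^sup>2 * r x) * G x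
      \<le> (g x + e * a)\<^sup>2 * (1 - e * y x - e\<^sup>2 * t) * G x"
    using G_pos[of x] by (simp add: mult_right_mono)
  also have "\<dots> \<le> (g x + e * a)\<^sup>2 * G (e *\<^sub>R h + x)"
    using mult_left_mono[OF G_translate_ge[of x e h], of "(g x + e * a)\<^sup>2"]
    by (simp add: y_def t_def mult_ac)
  finally show "(g x)\<^sup>2 * G x
      + e * ((2 * (k \<bullet> h) * (m + k \<bullet> x) - (m + k \<bullet> x)\<^sup>2 * (1 / s * (h \<bullet> H x))) * G x)
      - e\<^sup>2 * (r x * G x) \<le> (g (e *\<^sub>R h + x))\<^sup>2 * G (e *\<^sub>R h + x)"
    unfolding shift by (simp add: a_def y_def g_def algebra_simps)
qed

text \<open>
  The covariance of \<open>k \<bullet> x\<close> and \<open>h \<bullet> H x\<close> is \<open>s * (k \<bullet> h)\<close>: the covariance operator inverts the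
  precision \<open>H / s\<close>.  Of the integrand in the previous lemma, the difference of the instances
  \<open>m = 1\<close> and \<open>m = -1\<close> keeps only the part that is odd in \<open>m\<close>, which is the one wanted.
\<close>

lemma integral_second_moment:
  "(\<integral>x. ((k \<bullet> x) * (h \<bullet> H x)) * G x \<partial>lborel) = s * (k \<bullet> h) * (\<integral>x. G x \<partial>lborel)"
proof -
  let ?d = "\<lambda>m x. (2 * (k \<bullet> h) * (m + k \<bullet> x) - (m + k \<bullet> x)\<^sup>2 * (1 / s * (h \<bullet> H x))) * G x"
  have int: "integrable lborel (?d m)" for m by (intro integrable_G growth_intros)
  have int2: "integrable lborel (\<lambda>x. ((k \<bullet> x) * (h \<bullet> H x)) * G x)" by (intro integrable_G growth_intros)
  have int0: "integrable lborel G" using integrable_G[OF exp_growth_const[of 1]] by simp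
  have "0 = (\<integral>x. ?d 1 x - ?d (-1) x \<partial>lborel)"
    using int[of 1] int[of "-1"] integral_square_shift[of k h 1] integral_square_shift[of k h "-1"] by simp
  also have "\<dots> = (\<integral>x. 4 * (k \<bullet> h) * G x - 4 / s * (((k \<bullet> x) * (h \<bullet> H x)) * G x) \<partial>lborel)"
    by (intro Bochner_Integration.integral_cong refl) (simp add: power2_eq_square algebra_simps)
  also have "\<dots> = 4 * (k \<bullet> h) * (\<integral>x. G x \<partial>lborel) - 4 / s * (\<integral>x. ((k \<bullet> x) * (h \<bullet> H x)) * G x \<partial>lborel)"
    using int0 int2 by simp
  finally show ?thesis using s by (simp add: field_simps)
qed

end

section \<open>The Tikhonov matrix and its traces\<close>

lemma inner_transpose_mult:
  fixes M :: "real^'n^'k"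
  shows "x \<bullet> (transpose M *v y) = (M *v x) \<bullet> y"
  by (metis dot_lmul_matrix inner_commute transpose_matrix_vector)

lemma norm_square_matrix_vector:
  fixes M :: "real^'n^'k"
  shows "(norm (M *v x))\<^sup>2 = (\<Sum>i\<in>UNIV. (M $ i \<bullet> x)\<^sup>2)"
  unfolding power2_norm_eq_inner by (simp add: inner_vec_def[of "M *v x"] matrix_vector_mul_component power2_eq_square)

lemma trace_mult_gram:
  fixes B :: "real^'n^'k" and M :: "real^'n^'n"
  shows "trace (M ** (transpose B ** B)) = (\<Sum>i\<in>UNIV. B $ i \<bullet> (M *v B $ i))"
proof -
  have "trace (M ** (transpose B ** B)) = trace (B ** (M ** transpose B))"
    by (metis matrix_mul_assoc trace_mul_sym)
  then show ?thesis
    by (simp add: trace_def matrix_matrix_mult_def inner_vec_def matrix_vector_mult_def transpose_def)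
qed

lemma trace_mult_combination:
  fixes M X Y :: "real^'n^'n"
  shows "trace (M ** (X + l *\<^sub>R Y)) = trace (M ** X) + l * trace (M ** Y)"
  by (simp add: trace_def matrix_matrix_mult_def distrib_left sum.distrib sum_distrib_left mult_ac)

lemma matrix_inv_mult:
  fixes M :: "real^'n^'n"
  assumes "invertible M"
  shows "M ** matrix_inv M = mat 1" "matrix_inv M ** M = mat 1"
  using someI_ex[OF assms[unfolded invertible_def]] unfolding matrix_inv_def by blast+

lemma invertible_matrix_bounded_below:
  fixes T :: "real^'n^'n"
  assumes "invertible T"
  obtains B where "0 < B" "\<And>x. B * norm x \<le> norm (T *v x)"
proof -
  have "inj ((*v) T)" using assms by (simp add: invertible_eq_bij bij_def)
  then show ?thesis using linear_inj_bounded_below_pos[OF matrix_vector_mul_linear[of T]] that by blast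
qed

context
  fixes A :: "real^'n^'m" and T :: "real^'n^'n" and l :: real
  assumes T: "invertible T" and l: "0 < l"
begin

lemma tikhonov_matrix_vector:
  "tikhonov_matrix A T l *v x = transpose A *v (A *v x) + l *\<^sub>R (transpose T *v (T *v x))"
  unfolding tikhonov_matrix_def matrix_vector_mult_add_rdistrib scaleR_matrix_vector_assoc[symmetric]
    matrix_vector_mul_assoc[symmetric] ..

lemma inner_tikhonov_matrix:
  "x \<bullet> (tikhonov_matrix A T l *v y) = (A *v x) \<bullet> (A *v y) + l * ((T *v x) \<bullet> (T *v y))"
  unfolding tikhonov_matrix_vector by (simp only: inner_add_right inner_scaleR_right inner_transpose_mult)

lemma tikhonov_matrix_coercive:
  obtains c where "0 < c" "\<And>x. c * (norm x)\<^sup>2 \<le> x \<bullet> (tikhonov_matrix A T l *v x)"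
proof -
  obtain B where B: "0 < B" "\<And>x. B * norm x \<le> norm (T *v x)" using invertible_matrix_bounded_below[OF T] by blast
  have "(l * B\<^sup>2) * (norm x)\<^sup>2 \<le> x \<bullet> (tikhonov_matrix A T l *v x)" for x
  proof -
    have "(B * norm x)\<^sup>2 \<le> (norm (T *v x))\<^sup>2" using B by (intro power_mono) auto
    then have "l * (B * norm x)\<^sup>2 \<le> l * (norm (T *v x))\<^sup>2" using l by simp
    then show ?thesis by (simp add: inner_tikhonov_matrix power2_norm_eq_inner power_mult_distrib mult.assoc add_increasing)
  qed
  then show ?thesis using that[of "l * B\<^sup>2"] B l by auto
qed

lemma invertible_tikhonov_matrix: "invertible (tikhonov_matrix A T l)"
proof -
  obtain c where c: "0 < c" "\<And>x. c * (norm x)\<^sup>2 \<le> x \<bullet> (tikhonov_matrix A T l *v x)"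
    by (rule tikhonov_matrix_coercive) blast
  have "x = 0" if "tikhonov_matrix A T l *v x = 0" for x
    using c(2)[of x] c(1) that by (simp add: mult_le_0_iff)
  then show ?thesis
    by (simp add: invertible_left_inverse matrix_left_invertible_ker)
qed

lemma tikhonov_matrix_inv_vector:
  "tikhonov_matrix A T l *v (matrix_inv (tikhonov_matrix A T l) *v y) = y"
  by (simp add: matrix_vector_mul_assoc matrix_inv_mult invertible_tikhonov_matrix)

text \<open>
  With \<open>w\<close> the solution of \<open>H w = a\<close> for a row \<open>a\<close> of \<open>A\<close>, the leverage is
  \<open>q = norm (A w)\<^sup>2 + l * norm (T w)\<^sup>2\<close> and also a component of \<open>A w\<close>.  If \<open>w \<noteq> 0\<close>, then
  \<open>norm (A w)\<^sup>2 < q \<le> norm (A w)\<close>, which forces \<open>norm (A w) < 1\<close>.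
\<close>

lemma row_leverage:
  defines "q \<equiv> \<lambda>i. A $ i \<bullet> (matrix_inv (tikhonov_matrix A T l) *v A $ i)"
  shows "q i < 1" "0 \<le> q i" "A $ i \<noteq> 0 \<Longrightarrow> 0 < q i"
proof -
  define w where "w = matrix_inv (tikhonov_matrix A T l) *v A $ i"
  obtain c where c: "0 < c" "\<And>x. c * (norm x)\<^sup>2 \<le> x \<bullet> (tikhonov_matrix A T l *v x)"
    by (rule tikhonov_matrix_coercive) blast
  obtain B where B: "0 < B" "\<And>x. B * norm x \<le> norm (T *v x)" using invertible_matrix_bounded_below[OF T] by blast
  have Hw: "tikhonov_matrix A T l *v w = A $ i" by (simp add: w_def tikhonov_matrix_inv_vector)
  have q: "q i = w \<bullet> (tikhonov_matrix A T l *v w)"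
    unfolding q_def w_def[symmetric] Hw by (simp add: inner_commute)
  show "0 \<le> q i" using order_trans[OF _ c(2)[of w]] c(1) q by simp
  show "0 < q i" if "A $ i \<noteq> 0"
  proof -
    have "w \<noteq> 0" using Hw that by auto
    then have "0 < c * (norm w)\<^sup>2" using c(1) by simp
    then show ?thesis using c(2)[of w] q by linarith
  qed
  show "q i < 1"
  proof (cases "w = 0")
    case True
    then show ?thesis using q by simp
  next
    case False
    have "q i = (norm (A *v w))\<^sup>2 + l * (norm (T *v w))\<^sup>2"
      by (simp add: q inner_tikhonov_matrix power2_norm_eq_inner)
    moreover have "0 < norm (T *v w)"
      using B(2)[of w] mult_pos_pos[OF B(1), of "norm w"] False by (smt (verit) zero_less_norm_iff)
    ultimately have less: "(norm (A *v w))\<^sup>2 < q i" using l by simp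
    have "q i = (A *v w) $ i" by (simp add: q_def w_def matrix_vector_mul_component)
    also have "\<dots> \<le> norm (A *v w)"
      using component_le_norm_cart[of "A *v w" i] by simp
    finally have le: "q i \<le> norm (A *v w)" .
    have "norm (A *v w) < 1"
    proof (rule ccontr)
      assume "\<not> norm (A *v w) < 1"
      then have "norm (A *v w) * 1 \<le> norm (A *v w) * norm (A *v w)" by (intro mult_left_mono) auto
      with less le show False by (simp add: power2_eq_square)
    qed
    with le show ?thesis by simp
  qed
qed

text \<open>
  The trace is the sum of the leverages of the rows of \<open>A\<close>.  This bound makes the denominator of
  the formula for \<open>\<sigma>\<^sup>2\<close> positive.
\<close>

lemma trace_influence_less:
  "trace (matrix_inv (tikhonov_matrix A T l) ** (transpose A ** A)) < real CARD('m)"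
proof -
  have "trace (matrix_inv (tikhonov_matrix A T l) ** (transpose A ** A)) < (\<Sum>i\<in>(UNIV :: 'm set). 1)"
    unfolding trace_mult_gram by (intro sum_strict_mono row_leverage) auto
  then show ?thesis by simp
qed

text \<open>
  The sum of the leverages again, now with a nonzero row.  By the trace identity that follows, this
  is the sign of the denominator of the formula for \<open>\<eta>\<^sup>2\<close>.
\<close>

lemma trace_influence_pos:
  assumes "A \<noteq> 0"
  shows "0 < trace (matrix_inv (tikhonov_matrix A T l) ** (transpose A ** A))"
proof -
  obtain i where "A $ i \<noteq> 0" using assms by (metis vec_eq_iff zero_index)
  then show ?thesis
    unfolding trace_mult_gram by (intro sum_pos2[of _ i] row_leverage) auto
qed

text \<open>
  The trace of the identity, written as the inverse of \<open>H\<close> times \<open>H\<close>.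
\<close>

lemma trace_tikhonov_split:
  "trace (matrix_inv (tikhonov_matrix A T l) ** (transpose A ** A))
     + l * trace (matrix_inv (tikhonov_matrix A T l) ** (transpose T ** T)) = real CARD('n)"
proof -
  let ?M = "matrix_inv (tikhonov_matrix A T l)"
  have "real CARD('n) = trace (?M ** tikhonov_matrix A T l)"
    by (simp add: matrix_inv_mult invertible_tikhonov_matrix trace_I)
  also have "\<dots> = trace (?M ** (transpose A ** A)) + l * trace (?M ** (transpose T ** T))"
    unfolding tikhonov_matrix_def by (rule trace_mult_combination)
  finally show ?thesis ..
qed

end

section \<open>The posterior distribution\<close>

text \<open>
  The density of \<open>U\<close> given \<open>b\<close> up to a factor independent of \<open>u\<close>.  The parameters \<open>v\<close> and \<open>w\<close> are the
  variances \<open>\<sigma>\<^sup>2\<close> and \<open>\<eta>\<^sup>2\<close>, in which the exponents have the form of the stationarity lemma.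
\<close>

definition posterior_kernel :: "real^'n^'m \<Rightarrow> real^'n^'n \<Rightarrow> real^'m \<Rightarrow> real \<Rightarrow> real \<Rightarrow> real^'n \<Rightarrow> real" where
  "posterior_kernel A T b v w u =
     exp (- (norm (A *v u - b))\<^sup>2 / (2 * v)) * exp (- (norm (T *v u))\<^sup>2 / (2 * w))"

lemma borel_measurable_matrix_vector:
  fixes M :: "real^'n^'k"
  shows "(*v) M \<in> borel_measurable borel"
  by (intro borel_measurable_continuous_onI linear_continuous_on)
     (simp add: linear_conv_bounded_linear[symmetric] matrix_vector_mul_linear)

lemma residual_measurable [measurable]:
  fixes M :: "real^'n^'k"
  shows "(\<lambda>u. (norm (M *v u - d))\<^sup>2) \<in> borel_measurable borel"
  using borel_measurable_matrix_vector[of M] by measurable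

text \<open>
  The decay comes from the prior factor, since \<open>T\<close> is bounded below.
\<close>

lemma integrable_posterior_kernel:
  fixes A :: "real^'n^'m" and T :: "real^'n^'n"
  assumes T: "invertible T" and v: "0 < v" and w: "0 < w"
  shows "integrable lborel (posterior_kernel A T b v w)"
proof -
  obtain B where B: "0 < B" "\<And>x. B * norm x \<le> norm (T *v x)"
    using invertible_matrix_bounded_below[OF T] by blast
  have "integrable lborel (\<lambda>u. 1 * exp (- ((norm (A *v u - b))\<^sup>2 / (2 * v) + (norm (T *v u - 0))\<^sup>2 / (2 * w))))"
  proof (rule integrable_exp_growth_gaussian[OF exp_growth_const])
    show "0 < B\<^sup>2 / (2 * w)" using B w by simp
    show "(\<lambda>u. (norm (A *v u - b))\<^sup>2 / (2 * v) + (norm (T *v u - 0))\<^sup>2 / (2 * w)) \<in> borel_measurable borel"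
      by measurable
    fix u
    have "(B * norm u)\<^sup>2 \<le> (norm (T *v u))\<^sup>2" using B by (intro power_mono) auto
    then have "B\<^sup>2 / (2 * w) * (norm u)\<^sup>2 \<le> (norm (T *v u))\<^sup>2 / (2 * w)"
      using w by (simp add: power_mult_distrib divide_right_mono)
    then show "B\<^sup>2 / (2 * w) * (norm u)\<^sup>2 \<le> (norm (A *v u - b))\<^sup>2 / (2 * v) + (norm (T *v u - 0))\<^sup>2 / (2 * w)"
      using v by (simp add: add_increasing)
  qed
  then show ?thesis
    unfolding posterior_kernel_def[abs_def] by (simp add: exp_add[symmetric])
qed

lemma tikhonov_normal_equation:
  fixes A :: "real^'n^'m" and T :: "real^'n^'n"
  assumes "invertible T" "0 < l"
  shows "tikhonov_matrix A T l *v tikhonov_solution A T b l = transpose A *v b"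
  unfolding tikhonov_solution_def by (rule tikhonov_matrix_inv_vector[OF assms])

text \<open>
  The Tikhonov solution is the posterior mean: the normal equation makes the terms linear in \<open>x\<close>
  cancel.
\<close>

lemma posterior_kernel_complete_square:
  fixes A :: "real^'n^'m" and T :: "real^'n^'n" and b :: "real^'m"
  assumes T: "invertible T" and v: "0 < v" and w: "0 < w"
  defines "u0 \<equiv> tikhonov_solution A T b (v / w)"
  shows "posterior_kernel A T b v w (u0 + x)
       = posterior_kernel A T b v w u0 * exp (- ((x \<bullet> (tikhonov_matrix A T (v / w) *v x)) / (2 * v)))"
proof -
  define l where "l = v / w"
  have l: "0 < l" using v w by (simp add: l_def)
  have shift: "(norm (p + r))\<^sup>2 = (norm p)\<^sup>2 + 2 * (r \<bullet> p) + (norm r)\<^sup>2" for p r :: "real^'k"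
    by (simp add: power2_norm_eq_inner inner_add_left inner_add_right inner_commute)
  have "x \<bullet> (tikhonov_matrix A T l *v u0) = x \<bullet> (transpose A *v b)"
    unfolding u0_def l_def[symmetric] tikhonov_normal_equation[OF T l] ..
  then have cross: "(A *v x) \<bullet> (A *v u0 - b) + l * ((T *v x) \<bullet> (T *v u0)) = 0"
    unfolding inner_tikhonov_matrix[OF T l] inner_transpose_mult by (simp add: inner_diff_right)
  have "A *v (u0 + x) - b = (A *v u0 - b) + A *v x" "T *v (u0 + x) = T *v u0 + T *v x"
    by (simp_all add: matrix_vector_right_distrib)
  then have "(norm (A *v (u0 + x) - b))\<^sup>2 + l * (norm (T *v (u0 + x)))\<^sup>2
      = (norm (A *v u0 - b))\<^sup>2 + l * (norm (T *v u0))\<^sup>2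
        + 2 * ((A *v x) \<bullet> (A *v u0 - b) + l * ((T *v x) \<bullet> (T *v u0)))
        + x \<bullet> (tikhonov_matrix A T l *v x)"
    unfolding inner_tikhonov_matrix[OF T l]
    by (simp only: shift power2_norm_eq_inner[symmetric]) (simp add: algebra_simps)
  then have sq: "(norm (A *v (u0 + x) - b))\<^sup>2 + l * (norm (T *v (u0 + x)))\<^sup>2
      = (norm (A *v u0 - b))\<^sup>2 + l * (norm (T *v u0))\<^sup>2 + x \<bullet> (tikhonov_matrix A T l *v x)"
    unfolding cross by simp
  have kernel: "posterior_kernel A T b v w u = exp (- ((norm (A *v u - b))\<^sup>2 + l * (norm (T *v u))\<^sup>2) / (2 * v))" for u
    unfolding posterior_kernel_def exp_add[symmetric] l_def using v w by (simp add: field_simps)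
  show ?thesis
    unfolding kernel sq exp_add[symmetric] l_def[symmetric] by (simp add: add_divide_distrib diff_divide_distrib)
qed

lemma integral_posterior_kernel_pos:
  fixes A :: "real^'n^'m" and T :: "real^'n^'n"
  assumes T: "invertible T" and v: "0 < v" and w: "0 < w"
  shows "0 < (\<integral>u. posterior_kernel A T b v w u \<partial>lborel)"
proof -
  have "(\<integral>u. posterior_kernel A T b v w u \<partial>lborel) \<noteq> 0"
  proof
    assume "(\<integral>u. posterior_kernel A T b v w u \<partial>lborel) = 0"
    then have "AE u in lborel. posterior_kernel A T b v w u = 0"
      using integrable_posterior_kernel[OF assms]
      by (subst (asm) integral_nonneg_eq_0_iff_AE) (auto simp: posterior_kernel_def)
    then have "AE u in (lborel :: (real^'n) measure). False" by (simp add: posterior_kernel_def)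
    then show False by (simp add: eventually_False ae_filter_eq_bot_iff)
  qed
  moreover have "0 \<le> (\<integral>u. posterior_kernel A T b v w u \<partial>lborel)"
    by (intro integral_nonneg_AE) (simp add: posterior_kernel_def)
  ultimately show ?thesis by simp
qed

text \<open>
  Bias plus variance: \<open>B u - d\<close> has posterior mean \<open>B u0 - d\<close>, and the posterior covariance of \<open>u\<close> is
  \<open>v\<close> times the inverse of \<open>H\<close>.  The instances \<open>(A, b)\<close> and \<open>(T, 0)\<close> give the two formulas.
\<close>

lemma posterior_expected_residual:
  fixes A :: "real^'n^'m" and T :: "real^'n^'n" and B :: "real^'n^'k" and b :: "real^'m" and d :: "real^'k"
  assumes T: "invertible T" and v: "0 < v" and w: "0 < w"
  defines "u0 \<equiv> tikhonov_solution A T b (v / w)" and "H \<equiv> tikhonov_matrix A T (v / w)"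
  shows "(\<integral>u. (norm (B *v u - d))\<^sup>2 * posterior_kernel A T b v w u \<partial>lborel)
       = ((norm (B *v u0 - d))\<^sup>2 + v * trace (matrix_inv H ** (transpose B ** B)))
           * (\<integral>u. posterior_kernel A T b v w u \<partial>lborel)"
proof -
  define l where "l = v / w"
  have l: "0 < l" using v w by (simp add: l_def)
  have H: "H = tikhonov_matrix A T l" by (simp add: H_def l_def)
  obtain c where c: "0 < c" "\<And>x. c * (norm x)\<^sup>2 \<le> x \<bullet> (H *v x)"
    unfolding H by (rule tikhonov_matrix_coercive[OF T l]) blast
  interpret gaussian_weight "(*v) H" v c
    using v c matrix_vector_mul_linear[of H]
    by unfold_locales (auto simp: H inner_tikhonov_matrix[OF T l] inner_commute linear_iff)
  let ?K = "posterior_kernel A T b v w" and ?M = "matrix_inv H"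
  let ?Z = "\<integral>x. G x \<partial>lborel"
  have K: "?K (u0 + x) = ?K u0 * G x" for x
    unfolding G_def unfolding H_def u0_def by (rule posterior_kernel_complete_square[OF T v w])
  have HM: "H *v (?M *v y) = y" for y unfolding H by (rule tikhonov_matrix_inv_vector[OF T l])
  have move: "(?M *v y) \<bullet> (H *v x) = y \<bullet> x" for x y
    using sym[of "?M *v y" x] by (simp add: HM)
  have K_meas: "?K \<in> borel_measurable borel"
    using integrable_posterior_kernel[OF T v w, of A b] by auto
  have Z: "(\<integral>u. ?K u \<partial>lborel) = ?K u0 * ?Z"
    using integral_lborel_translate[OF K_meas, of u0] by (simp add: K)
  define p where "p = B *v u0 - d"
  let ?q = "transpose B *v p"
  have int0: "integrable lborel (\<lambda>x. (norm p)\<^sup>2 * G x)"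
    and int1: "integrable lborel (\<lambda>x. 2 * (?q \<bullet> x) * G x)"
    and int2: "integrable lborel (\<lambda>x. (B $ i \<bullet> x)\<^sup>2 * G x)" for i
    by (intro integrable_G growth_intros)+
  \<comment> \<open>\<open>B $ i \<bullet> x\<close> is \<open>h \<bullet> H x\<close> for \<open>h = ?M *v B $ i\<close>, the form of the moment lemmas.\<close>
  have second: "(\<integral>x. (B $ i \<bullet> x)\<^sup>2 * G x \<partial>lborel) = v * (B $ i \<bullet> (?M *v B $ i)) * ?Z" for i
    using integral_second_moment[of "B $ i" "?M *v B $ i"] by (simp only: move power2_eq_square)
  have "(\<integral>u. (norm (B *v u - d))\<^sup>2 * ?K u \<partial>lborel)
      = (\<integral>x. (norm (B *v (u0 + x) - d))\<^sup>2 * ?K (u0 + x) \<partial>lborel)"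
    using K_meas by (intro integral_lborel_translate[symmetric]) measurable
  also have "\<dots> = (\<integral>x. ?K u0 * ((norm p)\<^sup>2 * G x + 2 * (?q \<bullet> x) * G x + (\<Sum>i\<in>UNIV. (B $ i \<bullet> x)\<^sup>2 * G x)) \<partial>lborel)"
  proof (intro Bochner_Integration.integral_cong refl)
    fix x
    have "B *v (u0 + x) - d = p + B *v x" by (simp add: p_def matrix_vector_right_distrib)
    then have "(norm (B *v (u0 + x) - d))\<^sup>2 = (norm p)\<^sup>2 + 2 * ((B *v x) \<bullet> p) + (norm (B *v x))\<^sup>2"
      by (simp add: power2_norm_eq_inner inner_add_left inner_add_right inner_commute)
    also have "(B *v x) \<bullet> p = ?q \<bullet> x" using inner_transpose_mult[of x B p] by (simp only: inner_commute)
    finally show "(norm (B *v (u0 + x) - d))\<^sup>2 * ?K (u0 + x)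
        = ?K u0 * ((norm p)\<^sup>2 * G x + 2 * (?q \<bullet> x) * G x + (\<Sum>i\<in>UNIV. (B $ i \<bullet> x)\<^sup>2 * G x))"
      unfolding K norm_square_matrix_vector sum_distrib_right[symmetric] by (simp add: algebra_simps)
  qed
  also have "\<dots> = ?K u0 * ((norm p)\<^sup>2 * ?Z + 2 * (\<integral>x. (?q \<bullet> x) * G x \<partial>lborel)
      + (\<Sum>i\<in>UNIV. \<integral>x. (B $ i \<bullet> x)\<^sup>2 * G x \<partial>lborel))"
    using int0 int1 int2 by (simp add: mult.assoc)
  also have "(\<integral>x. (?q \<bullet> x) * G x \<partial>lborel) = 0"
    using integral_first_moment[of "?M *v ?q"] by (simp only: move)
  also have "(\<Sum>i\<in>UNIV. \<integral>x. (B $ i \<bullet> x)\<^sup>2 * G x \<partial>lborel)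
      = (\<Sum>i\<in>UNIV. v * (B $ i \<bullet> (?M *v B $ i)) * ?Z)"
    by (rule sum.cong[OF refl second])
  finally show ?thesis
    unfolding Z trace_mult_gram p_def by (simp add: sum_distrib_left sum_distrib_right algebra_simps)
qed


section \<open>Maximizers of the evidence\<close>

lemma evidence_eq:
  fixes A :: "real^'n^'m" and T :: "real^'n^'n" and b :: "real^'m"
  shows "evidence A T b s t = \<bar>det T\<bar> * (2 * pi) powr (- (real CARD('m) / 2)) * (2 * pi) powr (- (real CARD('n) / 2))
     * ((s\<^sup>2) powr (- (real CARD('m) / 2)) * (t\<^sup>2) powr (- (real CARD('n) / 2))
        * (\<integral>u. posterior_kernel A T b (s\<^sup>2) (t\<^sup>2) u \<partial>lborel))"
proof -
  have "likelihood A s u b * prior_density T t u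
     = \<bar>det T\<bar> * (2 * pi) powr (- (real CARD('m) / 2)) * (2 * pi) powr (- (real CARD('n) / 2))
     * ((s\<^sup>2) powr (- (real CARD('m) / 2)) * (t\<^sup>2) powr (- (real CARD('n) / 2))) * posterior_kernel A T b (s\<^sup>2) (t\<^sup>2) u" for u
    by (simp add: likelihood_def prior_density_def posterior_kernel_def powr_mult powr_minus field_simps)
  then show ?thesis by (simp add: evidence_def mult.assoc)
qed

text \<open>
  With \<open>\<eta>\<close> fixed the evidence has the form \<open>v powr (- m / 2)\<close> times an integral of
  \<open>exp (- R / (2 v))\<close>, where \<open>v = \<sigma>\<^sup>2\<close> and \<open>R\<close> is the squared residual; with \<open>\<sigma>\<close> fixed it has the same
  form in \<open>\<eta>\<^sup>2\<close>.  So the stationarity lemma for a scale applies to each parameter separately.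
\<close>

lemma evidence_maximizer_stationarity:
  fixes A :: "real^'n^'m" and T :: "real^'n^'n" and b :: "real^'m"
  assumes T: "invertible T" and s: "0 < s" and t: "0 < t"
    and max: "\<And>s' t'. 0 < s' \<Longrightarrow> 0 < t' \<Longrightarrow> evidence A T b s' t' \<le> evidence A T b s t"
  defines "K \<equiv> posterior_kernel A T b (s\<^sup>2) (t\<^sup>2)"
  shows "(\<integral>u. (norm (A *v u - b))\<^sup>2 * K u \<partial>lborel) = real CARD('m) * s\<^sup>2 * (\<integral>u. K u \<partial>lborel)"
    and "(\<integral>u. (norm (T *v u - 0))\<^sup>2 * K u \<partial>lborel) = real CARD('n) * t\<^sup>2 * (\<integral>u. K u \<partial>lborel)"
proof -
  define L where "L v w = v powr (- (real CARD('m) / 2)) * w powr (- (real CARD('n) / 2))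
        * (\<integral>u. posterior_kernel A T b v w u \<partial>lborel)" for v w
  have L: "L v w \<le> L (s\<^sup>2) (t\<^sup>2)" if "0 < v" "0 < w" for v w
  proof -
    have "det T \<noteq> 0" using T by (simp add: invertible_det_nz)
    then have "0 < \<bar>det T\<bar> * (2 * pi) powr (- (real CARD('m) / 2)) * (2 * pi) powr (- (real CARD('n) / 2))"
      by simp
    then show ?thesis
      using max[of "sqrt v" "sqrt w"] that unfolding evidence_eq L_def
      by (simp only: real_sqrt_gt_zero real_sqrt_pow2 less_imp_le mult_le_cancel_left_pos simp_thms)
  qed
  have "(\<integral>u. (norm (A *v u - b))\<^sup>2 * (exp (- (norm (A *v u - b))\<^sup>2 / (2 * s\<^sup>2)) * exp (- (norm (T *v u))\<^sup>2 / (2 * t\<^sup>2))) \<partial>lborel)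
      = 2 * (real CARD('m) / 2) * s\<^sup>2 * (\<integral>u. exp (- (norm (A *v u - b))\<^sup>2 / (2 * s\<^sup>2)) * exp (- (norm (T *v u))\<^sup>2 / (2 * t\<^sup>2)) \<partial>lborel)"
  proof (rule scale_stationarity)
    fix v :: real assume v: "0 < v"
    show "integrable lborel (\<lambda>u. exp (- (norm (A *v u - b))\<^sup>2 / (2 * v)) * exp (- (norm (T *v u))\<^sup>2 / (2 * t\<^sup>2)))"
      using integrable_posterior_kernel[OF T v, of "t\<^sup>2" A b] t by (simp add: posterior_kernel_def[abs_def])
    have "0 < t\<^sup>2 powr (- (real CARD('n) / 2))" using t by simp
    then show "v powr (- (real CARD('m) / 2)) * (\<integral>u. exp (- (norm (A *v u - b))\<^sup>2 / (2 * v)) * exp (- (norm (T *v u))\<^sup>2 / (2 * t\<^sup>2)) \<partial>lborel)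
      \<le> (s\<^sup>2) powr (- (real CARD('m) / 2)) * (\<integral>u. exp (- (norm (A *v u - b))\<^sup>2 / (2 * s\<^sup>2)) * exp (- (norm (T *v u))\<^sup>2 / (2 * t\<^sup>2)) \<partial>lborel)"
      using L[OF v, of "t\<^sup>2"] t unfolding L_def posterior_kernel_def mult.assoc
      by (simp only: mult.left_commute[of _ "t\<^sup>2 powr (- (real CARD('n) / 2))"] mult_le_cancel_left_pos zero_less_power)
  qed (use s residual_measurable[of A b] in auto)
  then show "(\<integral>u. (norm (A *v u - b))\<^sup>2 * K u \<partial>lborel) = real CARD('m) * s\<^sup>2 * (\<integral>u. K u \<partial>lborel)"
    by (simp add: K_def posterior_kernel_def)
  have swap: "posterior_kernel A T b v w u
      = exp (- (norm (T *v u - 0))\<^sup>2 / (2 * w)) * exp (- (norm (A *v u - b))\<^sup>2 / (2 * v))" for v w u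
    by (simp add: posterior_kernel_def mult.commute)
  have "(\<integral>u. (norm (T *v u - 0))\<^sup>2 * (exp (- (norm (T *v u - 0))\<^sup>2 / (2 * t\<^sup>2)) * exp (- (norm (A *v u - b))\<^sup>2 / (2 * s\<^sup>2))) \<partial>lborel)
      = 2 * (real CARD('n) / 2) * t\<^sup>2 * (\<integral>u. exp (- (norm (T *v u - 0))\<^sup>2 / (2 * t\<^sup>2)) * exp (- (norm (A *v u - b))\<^sup>2 / (2 * s\<^sup>2)) \<partial>lborel)"
  proof (rule scale_stationarity)
    fix w :: real assume w: "0 < w"
    show "integrable lborel (\<lambda>u. exp (- (norm (T *v u - 0))\<^sup>2 / (2 * w)) * exp (- (norm (A *v u - b))\<^sup>2 / (2 * s\<^sup>2)))"
      using integrable_posterior_kernel[OF T _ w, of "s\<^sup>2" A b] s by (simp add: posterior_kernel_def[abs_def] mult.commute)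
    have "0 < s\<^sup>2 powr (- (real CARD('m) / 2))" using s by simp
    then show "w powr (- (real CARD('n) / 2)) * (\<integral>u. exp (- (norm (T *v u - 0))\<^sup>2 / (2 * w)) * exp (- (norm (A *v u - b))\<^sup>2 / (2 * s\<^sup>2)) \<partial>lborel)
      \<le> (t\<^sup>2) powr (- (real CARD('n) / 2)) * (\<integral>u. exp (- (norm (T *v u - 0))\<^sup>2 / (2 * t\<^sup>2)) * exp (- (norm (A *v u - b))\<^sup>2 / (2 * s\<^sup>2)) \<partial>lborel)"
      using L[OF _ w, of "s\<^sup>2"] s unfolding L_def swap mult.assoc by (simp only: mult_le_cancel_left_pos zero_less_power)
  qed (use t residual_measurable[of T 0] in auto)
  then show "(\<integral>u. (norm (T *v u - 0))\<^sup>2 * K u \<partial>lborel) = real CARD('n) * t\<^sup>2 * (\<integral>u. K u \<partial>lborel)"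
    by (simp add: K_def posterior_kernel_def mult.commute)
qed

theorem theorem1:
  fixes A :: "real^'n^'m" and T :: "real^'n^'n" and b :: "real^'m" and \<sigma> \<eta> :: real
  assumes "invertible T"
    and "is_arg_max (\<lambda>(s, t). evidence A T b s t) (\<lambda>(s, t). 0 < s \<and> 0 < t) (\<sigma>, \<eta>)"
  shows "let l = \<sigma>\<^sup>2 / \<eta>\<^sup>2;
             H = tikhonov_matrix A T l;
             u = tikhonov_solution A T b l
         in \<sigma>\<^sup>2 = (norm (A *v u - b))\<^sup>2 /
                    (real CARD('m) - trace (matrix_inv H ** (transpose A ** A))) \<and>
            (A \<noteq> 0 \<longrightarrow>
             \<eta>\<^sup>2 = (norm (T *v u))\<^sup>2 /
                    (real CARD('n) - l * trace (matrix_inv H ** (transpose T ** T))))"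
proof -
  define l where "l = \<sigma>\<^sup>2 / \<eta>\<^sup>2"
  define H where "H = tikhonov_matrix A T l"
  define u where "u = tikhonov_solution A T b l"
  let ?K = "posterior_kernel A T b (\<sigma>\<^sup>2) (\<eta>\<^sup>2)"
  let ?trA = "trace (matrix_inv H ** (transpose A ** A))" and ?trT = "trace (matrix_inv H ** (transpose T ** T))"
  have pos: "0 < \<sigma>" "0 < \<eta>" using assms(2) by (auto simp: is_arg_max_def)
  have max: "evidence A T b s t \<le> evidence A T b \<sigma> \<eta>" if "0 < s" "0 < t" for s t
    using assms(2) that by (force simp: is_arg_max_def not_less)
  have pos2: "0 < \<sigma>\<^sup>2" "0 < \<eta>\<^sup>2" and l: "0 < l" using pos by (auto simp: l_def)
  have Z: "0 < (\<integral>x. ?K x \<partial>lborel)" by (rule integral_posterior_kernel_pos[OF assms(1) pos2])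
  have "real CARD('m) * \<sigma>\<^sup>2 = (norm (A *v u - b))\<^sup>2 + \<sigma>\<^sup>2 * ?trA"
    using evidence_maximizer_stationarity(1)[OF assms(1) pos max]
      posterior_expected_residual[OF assms(1) pos2, where A = A and b = b and B = A and d = b] Z by (simp add: u_def H_def l_def)
  then have "\<sigma>\<^sup>2 * (real CARD('m) - ?trA) = (norm (A *v u - b))\<^sup>2" by (simp add: algebra_simps)
  moreover have "0 < real CARD('m) - ?trA"
    using trace_influence_less[OF assms(1) l, of A] by (simp add: H_def)
  ultimately have 1: "\<sigma>\<^sup>2 = (norm (A *v u - b))\<^sup>2 / (real CARD('m) - ?trA)"
    by (simp add: eq_divide_eq)
  have 2: "\<eta>\<^sup>2 = (norm (T *v u))\<^sup>2 / (real CARD('n) - l * ?trT)" if "A \<noteq> 0"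
  proof -
    have "real CARD('n) * \<eta>\<^sup>2 = (norm (T *v u))\<^sup>2 + \<sigma>\<^sup>2 * ?trT"
      using evidence_maximizer_stationarity(2)[OF assms(1) pos max]
        posterior_expected_residual[OF assms(1) pos2, where A = A and b = b and B = T and d = 0] Z by (simp add: u_def H_def l_def)
    \<comment> \<open>This is where the definition of \<open>\<lambda>\<close> turns \<open>\<sigma>\<^sup>2\<close> into a multiple of \<open>\<eta>\<^sup>2\<close>.\<close>
    moreover have "\<sigma>\<^sup>2 = \<eta>\<^sup>2 * l" using pos by (simp add: l_def)
    ultimately have "\<eta>\<^sup>2 * (real CARD('n) - l * ?trT) = (norm (T *v u))\<^sup>2" by (simp add: algebra_simps)
    moreover have "0 < real CARD('n) - l * ?trT"
      using trace_tikhonov_split[OF assms(1) l, of A] trace_influence_pos[OF assms(1) l that] by (simp add: H_def)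
    ultimately show ?thesis by (simp add: eq_divide_eq)
  qed
  show ?thesis
    unfolding Let_def l_def[symmetric] H_def[symmetric] u_def[symmetric] using 1 2 by blast
qed

end
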